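(* Let $\tau>0$, let $X_1=\mathbb{R}^n$, $U_1=\bar U$, and let $S_1=(X_1,U_1,F_1)$ be the sampled system associated with the control system $\dot \xi(t)\in f(\xi(t),u)+[\![-w,w]\!]$ and sampling time $\tau$. Let $P\colon\mathbb{R}^n\rightrightarrows\mathbb{R}^n$, $P(x)=x+[\![-z,z]\!]$ with $z\in\mathbb{R}^n_+$, and let $\eta\in(\mathbb{R}_+\setminus\{0\})^n$. Let $S_2=(X_2,U_2,F_2)$ be a system with $U_2\subseteq U_1$, where $X_2$ is a cover of $X_1$ such that every $x_2\in X_2$ is of the form $\bar c+[\![-\eta/2,\eta/2]\!]$ with $\bar c\in\eta\mathbb{Z}^n$. For any $x_2\in X_2$ let $\beta_{x_2}$ be a growth bound on $P(x_2)$, $U_2$ associated with $\tau$ and the control system. Let $(x_2,u)\in X_2\times U_2$, and suppose that $\beta_{x_2}$ is of the form $$\beta_{x_2}(r,u)=\mathrm{e}^{L(u)\tau}r+v(u),$$ where $v(u)\in\mathbb{R}^n_+$ and $L(u)\in\mathbb{R}^{n\times n}$ is essentially nonnegative. Suppose that $$F_2(x_2,u)=\{x_2'\in X_2\mid (c+[\![-r',r']\!])\cap P(x_2')\neq\emptyset\},\qquad r'=\beta_{x_2}(\eta/2+z,u),$$ where $c=(c_1,\dots,c_n)$ is a vector of independent random variables $c_i$, $i\in\{1,\dots,n\}$, each of which is uniformly distributed on some interval of length $\eta_i$. Then the expected value of the number of cells in $F_2(x_2,u)$ (i.e., of its cardinality) is $$E(\eta)=\prod_{i=1}^n\frac{1}{\eta_i}\Bigl(p_i+\sum_{j=1}^nA_{i,j}\eta_j\Bigr)$$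 with $A=\mathrm{id}+\mathrm{e}^{L(u)\tau}$ and $p=2(Az+v(u))$.
   Context: Notation. Relations $\le,\ge$ on $\mathbb{R}^n$ are component-wise, $|x|=(|x_1|,\dots,|x_n|)$, $\mathbb{R}_+$ is the set of nonnegative reals, $\mathrm{id}$ is the identity matrix. For $a\le b$ in $\mathbb{R}^n$, $[\![a,b]\!]=[a_1,b_1]\times\cdots\times[a_n,b_n]$. A cover of a set $X$ is a set of subsets of $X$ whose union is $X$; the elements of $X_2$ are called cells. $\eta\mathbb{Z}^n=\{c\in\mathbb{R}^n\mid\exists k\in\mathbb{Z}^n\ \forall i:\ c_i=k_i\eta_i\}$. $F\colon A\rightrightarrows B$ denotes a set-valued map, and $P(M)=\bigcup_{x\in M}P(x)$ for sets $M$. A matrix $L\in\mathbb{R}^{n\times n}$ is essentially nonnegative if $L_{i,j}\ge0$ whenever $i\ne j$. Control system. $f\colon\mathbb{R}^n\times\bar U\to\mathbb{R}^n$, $\bar U\subseteq\mathbb{R}^m$ nonempty, $f(\cdot,u)$ locally Lipschitz for all $u\in\bar U$, $w\in\mathbb{R}^n_+$. A solution on $[0,\tau]$ with (constant) input $u\in\bar U$ is an absolutely continuous $\xi\colon[0,\tau]\to\mathbb{R}^n$ with $\dot\xi(t)\in f(\xi(t),u)+[\![-w,w]\!]$ for almost every $t\in[0,\tau]$. $\varphi(t,x_0,u)$ is the value at time $t$ of the solution of $\dot x=f(x,u)$, $x(0)=x_0$, and $\operatorname{dom}\varphi$ is the set of $(t,x_0,u)$ for which it exists. System. A system is a triple $(X,U,F)$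 with $X,U$ nonempty sets and $F\colon X\times U\rightrightarrows X$. The sampled system associated with the control system and $\tau$ is $(\mathbb{R}^n,\bar U,F)$ with $x_1\in F(x_0,u)$ iff there is a solution $\xi$ on $[0,\tau]$ with input $u$, $\xi(0)=x_0$, $\xi(\tau)=x_1$. Growth bound. For $K\subseteq\mathbb{R}^n$, $\bar U'\subseteq\bar U$, a map $\beta\colon\mathbb{R}^n_+\times\bar U'\to\mathbb{R}^n_+$ is a growth bound on $K,\bar U'$ associated with $\tau$ and the control system if (i) $\beta(r,u)\ge\beta(r',u)$ whenever $r\ge r'$, $u\in\bar U'$; (ii) $[0,\tau]\times K\times\bar U'\subseteq\operatorname{dom}\varphi$, and if $\xi$ is a solution on $[0,\tau]$ with input $u\in\bar U'$ and $\xi(0),p\in K$, then $|\xi(\tau)-\varphi(\tau,p,u)|\le\beta(|\xi(0)-p|,u)$. *)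

theory Defs
  imports "HOL-Probability.Probability"
begin

section \<open>Boxes, lattices and matrices\<close>

text \<open>On \<^typ>\<open>real ^ 'n\<close> the library's \<open>\<le>\<close> and \<open>\<bar>_\<bar>\<close> are component-wise, and \<open>cbox a b\<close> is the
  product of the intervals \<open>[a\<^sub>i, b\<^sub>i]\<close>.\<close>

definition box_around :: "real ^ 'n \<Rightarrow> real ^ 'n \<Rightarrow> (real ^ 'n) set" where
  "box_around c r = (\<lambda>y. c + y) ` cbox (- r) r"

definition lattice_pts :: "real ^ 'n \<Rightarrow> (real ^ 'n) set" where
  "lattice_pts \<eta> = {c. \<exists>k :: int ^ 'n. \<forall>i. c $ i = real_of_int (k $ i) * \<eta> $ i}"

definition is_cover :: "'a set set \<Rightarrow> 'a set \<Rightarrow> bool" where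
  "is_cover C X \<longleftrightarrow> (\<forall>x\<in>C. x \<subseteq> X) \<and> \<Union>C = X"

definition essentially_nonneg :: "real ^ 'n ^ 'n \<Rightarrow> bool" where
  "essentially_nonneg L \<longleftrightarrow> (\<forall>i j. i \<noteq> j \<longrightarrow> 0 \<le> L $ i $ j)"

text \<open>The class operations \<open>*\<close> and \<open>^\<close> on \<^typ>\<open>real ^ 'n ^ 'n\<close> act entry-wise, so powers with
  respect to the matrix product \<open>**\<close> are defined separately.\<close>

primrec matrix_power :: "real ^ 'n ^ 'n \<Rightarrow> nat \<Rightarrow> real ^ 'n ^ 'n" where
  "matrix_power M 0 = mat 1"
| "matrix_power M (Suc k) = M ** matrix_power M k"

definition matrix_exp :: "real ^ 'n ^ 'n \<Rightarrow> real ^ 'n ^ 'n" where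
  "matrix_exp M = (\<Sum>k. (1 / fact k) *\<^sub>R matrix_power M k)"


section \<open>Control systems\<close>

text \<open>Right-hand sides are total functions; values of \<open>f x u\<close> with \<open>u\<close> outside the input set are
  never used.\<close>

definition control_system ::
    "(real ^ 'n \<Rightarrow> real ^ 'm \<Rightarrow> real ^ 'n) \<Rightarrow> (real ^ 'm) set \<Rightarrow> real ^ 'n \<Rightarrow> bool" where
  "control_system f Ubar w \<longleftrightarrow>
     Ubar \<noteq> {} \<and> (\<forall>u\<in>Ubar. local_lipschitz {u} UNIV (\<lambda>u x. f x u)) \<and> 0 \<le> w"

text \<open>\<open>D division_of T\<close>: \<open>D\<close> is a finite family of closed intervals with pairwise disjoint interiors
  and union \<open>T\<close>.\<close>

definition abs_continuous_on :: "real \<Rightarrow> real \<Rightarrow> (real \<Rightarrow> 'a::real_normed_vector) \<Rightarrow> bool" where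
  "abs_continuous_on a b g \<longleftrightarrow>
     (\<forall>\<epsilon>>0. \<exists>\<delta>>0. \<forall>D T. D division_of T \<longrightarrow> T \<subseteq> {a..b} \<longrightarrow> (\<Sum>I\<in>D. Sup I - Inf I) < \<delta> \<longrightarrow>
        (\<Sum>I\<in>D. norm (g (Sup I) - g (Inf I))) < \<epsilon>)"

definition is_solution ::
    "(real ^ 'n \<Rightarrow> real ^ 'm \<Rightarrow> real ^ 'n) \<Rightarrow> (real ^ 'm) set \<Rightarrow> real ^ 'n \<Rightarrow> real \<Rightarrow> real ^ 'm \<Rightarrow>
     (real \<Rightarrow> real ^ 'n) \<Rightarrow> bool" where
  "is_solution f Ubar w \<tau> u \<xi> \<longleftrightarrow>
     u \<in> Ubar \<and> abs_continuous_on 0 \<tau> \<xi> \<and>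
     (AE t in lebesgue. t \<in> {0..\<tau>} \<longrightarrow>
        (\<exists>d \<in> box_around (f (\<xi> t) u) w. (\<xi> has_vector_derivative d) (at t within {0..\<tau>})))"

text \<open>Solutions of the unperturbed initial value problem, on the interval between \<open>0\<close> and \<open>t\<close>.\<close>

definition is_nominal_solution ::
    "(real ^ 'n \<Rightarrow> real ^ 'm \<Rightarrow> real ^ 'n) \<Rightarrow> real \<Rightarrow> real ^ 'n \<Rightarrow> real ^ 'm \<Rightarrow>
     (real \<Rightarrow> real ^ 'n) \<Rightarrow> bool" where
  "is_nominal_solution f t x0 u x \<longleftrightarrow>
     x 0 = x0 \<and>
     (\<forall>s\<in>closed_segment 0 t. (x has_vector_derivative f (x s) u) (at s within closed_segment 0 t))"

definition dom_flow ::
    "(real ^ 'n \<Rightarrow> real ^ 'm \<Rightarrow> real ^ 'n) \<Rightarrow> (real ^ 'm) set \<Rightarrow>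
     (real \<times> (real ^ 'n) \<times> (real ^ 'm)) set" where
  "dom_flow f Ubar = {(t, x0, u). u \<in> Ubar \<and> (\<exists>x. is_nominal_solution f t x0 u x)}"

text \<open>Only meaningful on \<^const>\<open>dom_flow\<close>; there the value is unique since \<open>f\<close> is locally Lipschitz
  in the state.\<close>

definition flow ::
    "(real ^ 'n \<Rightarrow> real ^ 'm \<Rightarrow> real ^ 'n) \<Rightarrow> real \<Rightarrow> real ^ 'n \<Rightarrow> real ^ 'm \<Rightarrow> real ^ 'n" where
  "flow f t x0 u = (THE y. \<exists>x. is_nominal_solution f t x0 u x \<and> x t = y)"


section \<open>Systems and growth bounds\<close>

type_synonym ('x, 'u) system = "'x set \<times> 'u set \<times> ('x \<Rightarrow> 'u \<Rightarrow> 'x set)"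

definition is_system :: "('x, 'u) system \<Rightarrow> bool" where
  "is_system S \<longleftrightarrow> (case S of (X, U, F) \<Rightarrow>
     X \<noteq> {} \<and> U \<noteq> {} \<and> (\<forall>x\<in>X. \<forall>u\<in>U. F x u \<subseteq> X))"

definition sampled_system ::
    "(real ^ 'n \<Rightarrow> real ^ 'm \<Rightarrow> real ^ 'n) \<Rightarrow> (real ^ 'm) set \<Rightarrow> real ^ 'n \<Rightarrow> real \<Rightarrow>
     (real ^ 'n, real ^ 'm) system" where
  "sampled_system f Ubar w \<tau> =
     (UNIV, Ubar, \<lambda>x0 u. {x1. \<exists>\<xi>. is_solution f Ubar w \<tau> u \<xi> \<and> \<xi> 0 = x0 \<and> \<xi> \<tau> = x1})"

definition growth_bound ::
    "(real ^ 'n \<Rightarrow> real ^ 'm \<Rightarrow> real ^ 'n) \<Rightarrow> (real ^ 'm) set \<Rightarrow> real ^ 'n \<Rightarrow> real \<Rightarrow>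
     (real ^ 'n) set \<Rightarrow> (real ^ 'm) set \<Rightarrow> (real ^ 'n \<Rightarrow> real ^ 'm \<Rightarrow> real ^ 'n) \<Rightarrow> bool" where
  "growth_bound f Ubar w \<tau> K U' \<beta> \<longleftrightarrow>
     U' \<subseteq> Ubar \<and>
     (\<forall>r\<ge>0. \<forall>u\<in>U'. 0 \<le> \<beta> r u) \<and>
     (\<forall>r\<ge>0. \<forall>r'\<ge>0. \<forall>u\<in>U'. r' \<le> r \<longrightarrow> \<beta> r' u \<le> \<beta> r u) \<and>
     {0..\<tau>} \<times> K \<times> U' \<subseteq> dom_flow f Ubar \<and>
     (\<forall>\<xi>. \<forall>u\<in>U'. \<forall>p\<in>K. is_solution f Ubar w \<tau> u \<xi> \<longrightarrow> \<xi> 0 \<in> K \<longrightarrow>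
        \<bar>\<xi> \<tau> - flow f \<tau> p u\<bar> \<le> \<beta> \<bar>\<xi> 0 - p\<bar> u)"

end

theory Submission
  imports Defs
begin

text \<open>The cells are the boxes of radius \<open>\<eta>/2\<close> around the lattice points \<open>k\<eta>\<close>, and the cell of \<open>k\<close> belongs
  to the image iff \<open>\<bar>c\<^sub>i - k\<^sub>i \<eta>\<^sub>i\<bar> \<le> R\<^sub>i\<close> for all \<open>i\<close>, where \<open>R = r' + \<eta>/2 + z\<close>. Hence the number of cells
  is the product over \<open>i\<close> of the number of multiples of \<open>\<eta>\<^sub>i\<close> within distance \<open>R\<^sub>i\<close> of \<open>c\<^sub>i\<close>. The
  factors are independent, and averaging the indicator of \<open>[-R\<^sub>i, R\<^sub>i]\<close>, summed over the translates by
  \<open>\<eta>\<^sub>i\<int>\<close>, over an interval of length \<open>\<eta>\<^sub>i\<close> gives \<open>2R\<^sub>i / \<eta>\<^sub>i\<close>.\<close>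

section \<open>Averaging lattice counts over one period\<close>

text \<open>The inequalities place \<open>k\<close> in the half-open interval of length 1 starting
  at \<open>(a - x) / h\<close>. Such an interval contains exactly one integer.\<close>

lemma lattice_translate_unique:
  fixes a h x :: real
  assumes h: "0 < h"
  shows "a \<le> x + of_int k * h \<and> x + of_int k * h < a + h \<longleftrightarrow> k = \<lceil>(a - x) / h\<rceil>"
proof -
  have "k = \<lceil>(a - x) / h\<rceil> \<longleftrightarrow> of_int k - 1 < (a - x) / h \<and> (a - x) / h \<le> of_int k"
    by (metis ceiling_unique ceiling_correct)
  also have "\<dots> \<longleftrightarrow> (of_int k - 1) * h < a - x \<and> a - x \<le> of_int k * h"
    using h by (simp add: pos_less_divide_eq pos_divide_le_eq)
  also have "\<dots> \<longleftrightarrow> a \<le> x + of_int k * h \<and> x + of_int k * h < a + h"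
    by (auto simp: algebra_simps)
  finally show ?thesis by simp
qed

text \<open>The unfolding argument: by Tonelli the sum and the integral may be exchanged, and
  shifting the k-th summand by \<open>k * h\<close> moves the shift from \<open>f\<close> to the
  interval. The shifted intervals tile the line, so the pieces add up to the whole integral.\<close>

lemma nn_integral_periodization:
  fixes f :: "real \<Rightarrow> ennreal" and a h :: real
  assumes [measurable]: "f \<in> borel_measurable borel" and h: "0 < h"
  shows "(\<integral>\<^sup>+x. (\<integral>\<^sup>+(k::int). f (x - of_int k * h) \<partial>count_space UNIV) * indicator {a..a + h} x \<partial>lborel)
         = (\<integral>\<^sup>+x. f x \<partial>lborel)"
proof -
  let ?S = "{a..<a + h}"
  \<comment> \<open>Translates of the closed interval overlap at endpoints. Dropping the right
    endpoint, a null set, makes every point lie in exactly one translate.\<close>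
  have "AE x in lborel. x \<noteq> a + h"
    by (rule AE_lborel_singleton)
  then have "AE x in lborel. indicator {a..a + h} x = (indicator ?S x :: ennreal)"
    by eventually_elim (auto simp: indicator_def)
  then have "(\<integral>\<^sup>+x. (\<integral>\<^sup>+(k::int). f (x - of_int k * h) \<partial>count_space UNIV) * indicator {a..a + h} x \<partial>lborel)
      = (\<integral>\<^sup>+x. (\<integral>\<^sup>+(k::int). f (x - of_int k * h) \<partial>count_space UNIV) * indicator ?S x \<partial>lborel)"
    by (intro nn_integral_cong_AE) (auto elim: eventually_mono)
  also have "\<dots> = (\<integral>\<^sup>+x. (\<integral>\<^sup>+(k::int). f (x - of_int k * h) * indicator ?S x \<partial>count_space UNIV) \<partial>lborel)"
    by (intro nn_integral_cong nn_integral_multc[symmetric]) auto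
  also have "\<dots> = (\<integral>\<^sup>+(k::int). (\<integral>\<^sup>+x. f (x - of_int k * h) * indicator ?S x \<partial>lborel) \<partial>count_space UNIV)"
    by (intro nn_integral_count_space_nn_integral) auto
  also have "\<dots> = (\<integral>\<^sup>+(k::int). (\<integral>\<^sup>+x. f x * indicator ?S (x + of_int k * h) \<partial>lborel) \<partial>count_space UNIV)"
  proof (rule nn_integral_cong)
    fix k :: int
    show "(\<integral>\<^sup>+x. f (x - of_int k * h) * indicator ?S x \<partial>lborel)
        = (\<integral>\<^sup>+x. f x * indicator ?S (x + of_int k * h) \<partial>lborel)"
      by (subst nn_integral_real_affine[where c = 1 and t = "of_int k * h"]) (auto simp: add.commute)
  qed
  also have "\<dots> = (\<integral>\<^sup>+x. (\<integral>\<^sup>+(k::int). f x * indicator ?S (x + of_int k * h) \<partial>count_space UNIV) \<partial>lborel)"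
    by (intro nn_integral_count_space_nn_integral[symmetric]) auto
  also have "\<dots> = (\<integral>\<^sup>+x. f x \<partial>lborel)"
  proof (rule nn_integral_cong)
    fix x :: real
    have "indicator ?S (x + of_int k * h) = (indicator {\<lceil>(a - x) / h\<rceil>} k :: ennreal)" for k :: int
      using lattice_translate_unique[OF h, of a x k] by (auto simp: indicator_def)
    then show "(\<integral>\<^sup>+(k::int). f x * indicator ?S (x + of_int k * h) \<partial>count_space UNIV) = f x"
      by (simp add: nn_integral_cmult_indicator)
  qed
  finally show ?thesis .
qed

lemma lattice_near_eq_interval:
  fixes h R x :: real
  assumes "0 < h"
  shows "{k::int. \<bar>x - of_int k * h\<bar> \<le> R} = {\<lceil>(x - R) / h\<rceil>..\<lfloor>(x + R) / h\<rfloor>}"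
  using assms by (auto simp: ceiling_le_iff le_floor_iff field_simps abs_le_iff)

lemma borel_measurable_card_lattice_near:
  fixes h R :: real
  assumes "0 < h"
  shows "(\<lambda>x. real (card {k::int. \<bar>x - of_int k * h\<bar> \<le> R})) \<in> borel_measurable borel"
proof -
  have "(\<lambda>x. real (card {k::int. \<bar>x - of_int k * h\<bar> \<le> R}))
      = (\<lambda>x. max 0 (real_of_int \<lfloor>(x + R) / h\<rfloor> - real_of_int \<lceil>(x - R) / h\<rceil> + 1))"
    unfolding lattice_near_eq_interval[OF assms] by (auto simp: fun_eq_iff max_def)
  also have "\<dots> \<in> borel_measurable borel"
    by measurable
  finally show ?thesis .
qed

lemma nn_integral_card_lattice_near:
  fixes a h R :: real
  assumes h: "0 < h" and R: "0 \<le> R"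
  shows "(\<integral>\<^sup>+x. ennreal (real (card {k::int. \<bar>x - of_int k * h\<bar> \<le> R}))
            \<partial>uniform_measure lborel {a..a + h}) = ennreal (2 * R / h)"
proof -
  have card_eq: "ennreal (real (card {k::int. \<bar>x - of_int k * h\<bar> \<le> R}))
      = (\<integral>\<^sup>+(k::int). indicator {-R..R} (x - of_int k * h) \<partial>count_space UNIV)" for x
  proof -
    let ?K = "{k::int. \<bar>x - of_int k * h\<bar> \<le> R}"
    \<comment> \<open>Finiteness ties \<open>card\<close> to the counting measure: on infinite sets
      \<open>card\<close> is 0 but the measure is infinite.\<close>
    have "finite ?K"
      by (simp add: lattice_near_eq_interval[OF h])
    then have "ennreal (real (card ?K)) = emeasure (count_space UNIV) ?K"
      by (simp add: emeasure_count_space_finite ennreal_of_nat_eq_real_of_nat)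
    also have "\<dots> = (\<integral>\<^sup>+k. indicator ?K k \<partial>count_space UNIV)"
      by simp
    also have "\<dots> = (\<integral>\<^sup>+(k::int). indicator {-R..R} (x - of_int k * h) \<partial>count_space UNIV)"
      by (intro nn_integral_cong) (auto simp: indicator_def abs_le_iff)
    finally show ?thesis .
  qed
  have "(\<integral>\<^sup>+x. ennreal (real (card {k::int. \<bar>x - of_int k * h\<bar> \<le> R}))
            \<partial>uniform_measure lborel {a..a + h})
      = (\<integral>\<^sup>+x. ennreal (real (card {k::int. \<bar>x - of_int k * h\<bar> \<le> R})) * indicator {a..a + h} x
            \<partial>lborel) / emeasure lborel {a..a + h}"
    using borel_measurable_card_lattice_near[OF h]
    by (intro nn_integral_uniform_measure) auto
  also have "\<dots> = (\<integral>\<^sup>+x. indicator {-R..R} x \<partial>lborel) / ennreal h"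
    unfolding card_eq by (subst nn_integral_periodization) (use h in auto)
  also have "\<dots> = ennreal (2 * R / h)"
    using h R by (simp add: divide_ennreal)
  finally show ?thesis .
qed

section \<open>Product sets and intersections of boxes\<close>

lemma card_vec_Pi:
  fixes K :: "'n::finite \<Rightarrow> 'a set"
  assumes "\<And>i. finite (K i)"
  shows "finite {k :: 'a ^ 'n. \<forall>i. k $ i \<in> K i}"
    and "card {k :: 'a ^ 'n. \<forall>i. k $ i \<in> K i} = (\<Prod>i\<in>UNIV. card (K i))"
proof -
  have bij: "bij_betw vec_nth {k :: 'a ^ 'n. \<forall>i. k $ i \<in> K i} (Pi\<^sub>E UNIV K)"
    by (rule bij_betwI[where g = vec_lambda]) auto
  show "finite {k :: 'a ^ 'n. \<forall>i. k $ i \<in> K i}"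
    using bij_betw_finite[OF bij] assms by (simp add: finite_PiE)
  show "card {k :: 'a ^ 'n. \<forall>i. k $ i \<in> K i} = (\<Prod>i\<in>UNIV. card (K i))"
    using bij_betw_same_card[OF bij] by (simp add: card_PiE)
qed

lemma mem_box_around: "y \<in> box_around c r \<longleftrightarrow> (\<forall>i. \<bar>y $ i - c $ i\<bar> \<le> r $ i)"
proof -
  have "y \<in> box_around c r \<longleftrightarrow> y - c \<in> cbox (- r) r"
    unfolding box_around_def by (force intro: image_eqI[where x = "y - c"])
  also have "\<dots> \<longleftrightarrow> (\<forall>i. \<bar>y $ i - c $ i\<bar> \<le> r $ i)"
    by (auto simp: mem_box_cart abs_le_iff) (smt (verit))+
  finally show ?thesis .
qed

text \<open>The coordinates decouple, and on the line the radii add: one direction is the triangle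
  inequality, the other picks suitable points coordinate by coordinate.\<close>

lemma box_around_meets_inflated_box:
  fixes c d r e z :: "real ^ 'n"
  assumes "0 \<le> r" "0 \<le> e" "0 \<le> z"
  shows "box_around c r \<inter> (\<Union>x\<in>box_around d e. box_around x z) \<noteq> {} \<longleftrightarrow>
         (\<forall>i. \<bar>c $ i - d $ i\<bar> \<le> r $ i + e $ i + z $ i)"
    (is "?L \<longleftrightarrow> ?R")
proof
  assume ?L
  then obtain y x where "y \<in> box_around c r" "x \<in> box_around d e" "y \<in> box_around x z"
    by auto
  then have "\<forall>i. \<bar>y $ i - c $ i\<bar> \<le> r $ i \<and> \<bar>x $ i - d $ i\<bar> \<le> e $ i \<and> \<bar>y $ i - x $ i\<bar> \<le> z $ i"
    by (simp add: mem_box_around)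
  then show ?R by (smt (verit))
next
  assume R: ?R
  have "\<forall>i. \<exists>s t. \<bar>s - c $ i\<bar> \<le> r $ i \<and> \<bar>t - d $ i\<bar> \<le> e $ i \<and> \<bar>s - t\<bar> \<le> z $ i"
  proof
    fix i
    have nn: "0 \<le> r $ i" "0 \<le> e $ i" "0 \<le> z $ i"
      using assms by (auto simp: less_eq_vec_def)
    \<comment> \<open>\<open>s\<close> is the point of the interval around \<open>c $ i\<close>
      nearest to \<open>d $ i\<close>, and \<open>t\<close> is the point of the interval around
      \<open>d $ i\<close> nearest to \<open>s\<close>.\<close>
    define s where "s = max (c $ i - r $ i) (min (c $ i + r $ i) (d $ i))"
    define t where "t = max (d $ i - e $ i) (min (d $ i + e $ i) s)"
    have s: "\<bar>s - c $ i\<bar> \<le> r $ i" "\<bar>s - d $ i\<bar> \<le> e $ i + z $ i"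
      using nn R[rule_format, of i] unfolding s_def max_def min_def by (auto split: if_splits)
    have "\<bar>t - d $ i\<bar> \<le> e $ i" "\<bar>s - t\<bar> \<le> z $ i"
      using nn s unfolding t_def max_def min_def by (auto split: if_splits)
    with s have "\<bar>s - c $ i\<bar> \<le> r $ i \<and> \<bar>t - d $ i\<bar> \<le> e $ i \<and> \<bar>s - t\<bar> \<le> z $ i"
      by blast
    then show "\<exists>s t. \<bar>s - c $ i\<bar> \<le> r $ i \<and> \<bar>t - d $ i\<bar> \<le> e $ i \<and> \<bar>s - t\<bar> \<le> z $ i"
      by blast
  qed
  then obtain s t where
    "\<forall>i. \<bar>s i - c $ i\<bar> \<le> r $ i \<and> \<bar>t i - d $ i\<bar> \<le> e $ i \<and> \<bar>s i - t i\<bar> \<le> z $ i"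
    by metis
  then have "vec_lambda s \<in> box_around c r" "vec_lambda t \<in> box_around d e"
    "vec_lambda s \<in> box_around (vec_lambda t) z"
    by (simp_all add: mem_box_around)
  then show ?L by blast
qed

section \<open>Lattice cells and covers made of them\<close>

text \<open>Indexing by integer vectors turns counting cells into counting points of a product
  set.\<close>

definition lattice_cell :: "real ^ 'n \<Rightarrow> int ^ 'n \<Rightarrow> (real ^ 'n) set" where
  "lattice_cell \<eta> k = box_around (\<chi> i. of_int (k $ i) * \<eta> $ i) (\<eta> /\<^sub>R 2)"

text \<open>Distinct lattice points differ in some coordinate by at least \<open>\<eta> $ i\<close>,
  more than the radius \<open>\<eta> $ i / 2\<close>. Centres therefore identify their cells,
  although neighbouring cells share boundary points.\<close>

lemma lattice_point_mem_lattice_cell_iff: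
  assumes "\<And>i. 0 < \<eta> $ i"
  shows "(\<chi> i. of_int (k $ i) * \<eta> $ i) \<in> lattice_cell \<eta> l \<longleftrightarrow> k = l"
proof
  assume mem: "(\<chi> i. of_int (k $ i) * \<eta> $ i) \<in> lattice_cell \<eta> l"
  have "k $ i = l $ i" for i
  proof -
    have "\<bar>of_int (k $ i) * \<eta> $ i - of_int (l $ i) * \<eta> $ i\<bar> \<le> \<eta> $ i / 2"
      using mem by (simp add: lattice_cell_def mem_box_around)
    moreover have "\<bar>of_int (k $ i) * \<eta> $ i - of_int (l $ i) * \<eta> $ i\<bar>
        = \<bar>of_int (k $ i - l $ i)\<bar> * \<eta> $ i"
      using assms[of i] by (simp flip: left_diff_distrib add: abs_mult)
    ultimately have "\<bar>real_of_int (k $ i - l $ i)\<bar> * \<eta> $ i \<le> 1 / 2 * \<eta> $ i"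
      by simp
    then have "\<bar>real_of_int (k $ i - l $ i)\<bar> \<le> 1 / 2"
      using assms[of i] mult_le_cancel_right_pos by blast
    then show ?thesis by linarith
  qed
  then show "k = l" by (simp add: vec_eq_iff)
next
  assume "k = l"
  then show "(\<chi> i. of_int (k $ i) * \<eta> $ i) \<in> lattice_cell \<eta> l"
    using assms by (simp add: lattice_cell_def mem_box_around less_imp_le)
qed

lemma inj_lattice_cell:
  assumes "\<And>i. 0 < \<eta> $ i"
  shows "inj (lattice_cell \<eta>)"
proof (rule injI)
  fix k l assume "lattice_cell \<eta> k = lattice_cell \<eta> l"
  then show "k = l"
    using lattice_point_mem_lattice_cell_iff[OF assms, of k k]
      lattice_point_mem_lattice_cell_iff[OF assms, of k l] by simp
qed

text \<open>A cover of the space by lattice cells must use all of them, since the centre of a cell lies in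
  no other cell.\<close>

lemma lattice_cell_cover_eq_range:
  fixes \<eta> :: "real ^ 'n"
  assumes pos: "\<And>i. 0 < \<eta> $ i"
    and cover: "is_cover X2 UNIV"
    and cells: "\<And>y. y \<in> X2 \<Longrightarrow> \<exists>cbar \<in> lattice_pts \<eta>. y = box_around cbar (\<eta> /\<^sub>R 2)"
  shows "X2 = range (lattice_cell \<eta>)"
proof -
  have sub: "\<exists>k. y = lattice_cell \<eta> k" if y: "y \<in> X2" for y
  proof -
    obtain d and k :: "int ^ 'n"
      where "y = box_around d (\<eta> /\<^sub>R 2)" "\<forall>i. d $ i = real_of_int (k $ i) * \<eta> $ i"
      using cells[OF y] by (auto simp: lattice_pts_def)
    moreover from this have "d = (\<chi> i. of_int (k $ i) * \<eta> $ i)"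
      by (simp add: vec_eq_iff)
    ultimately show ?thesis by (auto simp: lattice_cell_def)
  qed
  have "lattice_cell \<eta> k \<in> X2" for k
  proof -
    obtain y where "y \<in> X2" "(\<chi> i. of_int (k $ i) * \<eta> $ i) \<in> y"
      using cover unfolding is_cover_def by blast
    then show ?thesis
      using sub lattice_point_mem_lattice_cell_iff[OF pos] by metis
  qed
  with sub show ?thesis by blast
qed

section \<open>Expectation of the cardinality of the image\<close>

text \<open>Finiteness and integrability belong to the conclusion because \<open>card\<close> of an
  infinite set and the integral of a non-integrable function both default to 0. The formula thus
  concerns a genuine expected value.\<close>

theorem mainTheorem2:
  fixes f :: "real ^ 'n \<Rightarrow> real ^ 'm \<Rightarrow> real ^ 'n"
    and Ubar U1 U2 :: "(real ^ 'm) set"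
    and w z \<eta> p r' :: "real ^ 'n"
    and \<tau> :: real
    and X1 :: "(real ^ 'n) set"
    and F1 :: "real ^ 'n \<Rightarrow> real ^ 'm \<Rightarrow> (real ^ 'n) set"
    and P :: "real ^ 'n \<Rightarrow> (real ^ 'n) set"
    and X2 :: "(real ^ 'n) set set"
    and F2 :: "'w \<Rightarrow> (real ^ 'n) set \<Rightarrow> real ^ 'm \<Rightarrow> (real ^ 'n) set set"
    and \<beta> :: "(real ^ 'n) set \<Rightarrow> real ^ 'n \<Rightarrow> real ^ 'm \<Rightarrow> real ^ 'n"
    and L :: "real ^ 'm \<Rightarrow> real ^ 'n ^ 'n"
    and v :: "real ^ 'm \<Rightarrow> real ^ 'n"
    and x2 :: "(real ^ 'n) set"
    and u :: "real ^ 'm"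
    and \<Omega> :: "'w measure"
    and c :: "'w \<Rightarrow> real ^ 'n"
    and A :: "real ^ 'n ^ 'n"
  assumes "control_system f Ubar w"
    and "\<tau> > 0"
    and "(X1, U1, F1) = sampled_system f Ubar w \<tau>"
    and "0 \<le> z"
    and "\<And>x. P x = box_around x z"
    and "\<And>i. 0 < \<eta> $ i"
    and "\<And>\<omega>. \<omega> \<in> space \<Omega> \<Longrightarrow> is_system (X2, U2, F2 \<omega>)"
    and "U2 \<subseteq> U1"
    and "is_cover X2 X1"
    and "\<And>y. y \<in> X2 \<Longrightarrow> \<exists>cbar \<in> lattice_pts \<eta>. y = box_around cbar (\<eta> /\<^sub>R 2)"
    and "\<And>y. y \<in> X2 \<Longrightarrow> growth_bound f Ubar w \<tau> (\<Union>x\<in>y. P x) U2 (\<beta> y)"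
    and "x2 \<in> X2" and "u \<in> U2"
    and "0 \<le> v u" and "essentially_nonneg (L u)"
    and "\<And>r. 0 \<le> r \<Longrightarrow> \<beta> x2 r u = matrix_exp (\<tau> *\<^sub>R L u) *v r + v u"
    and "r' = \<beta> x2 (\<eta> /\<^sub>R 2 + z) u"
    and "prob_space \<Omega>"
    and "prob_space.indep_vars \<Omega> (\<lambda>_. borel) (\<lambda>i \<omega>. c \<omega> $ i) (UNIV :: 'n set)"
    and "\<And>i. \<exists>a. distr \<Omega> borel (\<lambda>\<omega>. c \<omega> $ i) = uniform_measure lborel {a..a + \<eta> $ i}"
    and "\<And>\<omega>. \<omega> \<in> space \<Omega> \<Longrightarrow>
           F2 \<omega> x2 u = {x2' \<in> X2. box_around (c \<omega>) r' \<inter> (\<Union>x\<in>x2'. P x) \<noteq> {}}"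
    and "A = mat 1 + matrix_exp (\<tau> *\<^sub>R L u)"
    and "p = 2 *\<^sub>R (A *v z + v u)"
  shows "(\<forall>\<omega>\<in>space \<Omega>. finite (F2 \<omega> x2 u)) \<and>
         integrable \<Omega> (\<lambda>\<omega>. real (card (F2 \<omega> x2 u))) \<and>
         prob_space.expectation \<Omega> (\<lambda>\<omega>. real (card (F2 \<omega> x2 u))) =
           (\<Prod>i\<in>UNIV. 1 / \<eta> $ i * (p $ i + (\<Sum>j\<in>UNIV. A $ i $ j * \<eta> $ j)))"
proof -
  interpret prob_space \<Omega> by (rule assms(18))
  have pos: "\<And>i. 0 < \<eta> $ i" by (rule assms(6))
  have z: "0 \<le> z" by (rule assms(4))
  have \<eta>2: "0 \<le> \<eta> /\<^sub>R 2"
    using pos by (simp add: less_eq_vec_def less_imp_le)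
  have X1: "X1 = UNIV" using assms(3) by (simp add: sampled_system_def)
  have X2: "X2 = range (lattice_cell \<eta>)"
    using assms(9,10) unfolding X1 by (intro lattice_cell_cover_eq_range pos)
  \<comment> \<open>A growth bound maps nonnegative radii to nonnegative radii.\<close>
  have r': "0 \<le> r'"
    using assms(11)[OF assms(12)] assms(13) z \<eta>2 unfolding assms(17) growth_bound_def
    by (simp add: add_nonneg_nonneg)

  define R where "R = r' + \<eta> /\<^sub>R 2 + z"
  have R_nonneg: "0 \<le> R $ i" for i
    using r' z \<eta>2 unfolding R_def by (simp add: less_eq_vec_def)
  define N where "N i x = real (card {k::int. \<bar>x - of_int k * \<eta> $ i\<bar> \<le> R $ i})" for i x

  \<comment> \<open>The index set is constrained in each coordinate separately, which is the form
    that \<open>card_vec_Pi\<close> counts.\<close>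
  have F2: "F2 \<omega> x2 u
      = lattice_cell \<eta> ` {k. \<forall>i. k $ i \<in> {k. \<bar>c \<omega> $ i - of_int k * \<eta> $ i\<bar> \<le> R $ i}}"
    if "\<omega> \<in> space \<Omega>" for \<omega>
  proof -
    have "box_around (c \<omega>) r' \<inter> (\<Union>x\<in>lattice_cell \<eta> k. P x) \<noteq> {} \<longleftrightarrow>
        (\<forall>i. \<bar>c \<omega> $ i - of_int (k $ i) * \<eta> $ i\<bar> \<le> R $ i)" for k
      unfolding lattice_cell_def assms(5) box_around_meets_inflated_box[OF r' \<eta>2 z]
      by (simp add: R_def)
    moreover have "{y \<in> range (lattice_cell \<eta>). Q y}
        = lattice_cell \<eta> ` {k. Q (lattice_cell \<eta> k)}" for Q
      by blast
    ultimately show ?thesis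
      unfolding assms(21)[OF that] X2 by simp
  qed
  have fin: "finite {k::int. \<bar>x - of_int k * \<eta> $ i\<bar> \<le> R $ i}" for x i
    by (simp add: lattice_near_eq_interval[OF pos])
  have F2_finite: "finite (F2 \<omega> x2 u)" if "\<omega> \<in> space \<Omega>" for \<omega>
    unfolding F2[OF that] by (intro finite_imageI card_vec_Pi(1) fin)
  have F2_card: "real (card (F2 \<omega> x2 u)) = (\<Prod>i\<in>UNIV. N i (c \<omega> $ i))" if "\<omega> \<in> space \<Omega>" for \<omega>
    unfolding F2[OF that] N_def card_image[OF inj_on_subset[OF inj_lattice_cell[OF pos] subset_UNIV]]
    by (subst card_vec_Pi(2)[OF fin]) simp

  have N_meas [measurable]: "N i \<in> borel_measurable borel" for i
    unfolding N_def by (rule borel_measurable_card_lattice_near[OF pos])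
  have c_meas [measurable]: "(\<lambda>\<omega>. c \<omega> $ i) \<in> borel_measurable \<Omega>" for i
    using assms(19) by (simp add: indep_vars_def2)
  \<comment> \<open>Only the law of the coordinate enters, and the left endpoint \<open>a\<close>
    drops out. The nonnegative integral delivers both integrability and the expectation.\<close>
  have nn: "(\<integral>\<^sup>+\<omega>. ennreal (N i (c \<omega> $ i)) \<partial>\<Omega>) = ennreal (2 * R $ i / \<eta> $ i)" for i
  proof -
    obtain a where a: "distr \<Omega> borel (\<lambda>\<omega>. c \<omega> $ i) = uniform_measure lborel {a..a + \<eta> $ i}"
      using assms(20) by blast
    have "(\<integral>\<^sup>+\<omega>. ennreal (N i (c \<omega> $ i)) \<partial>\<Omega>)
        = (\<integral>\<^sup>+x. ennreal (N i x) \<partial>distr \<Omega> borel (\<lambda>\<omega>. c \<omega> $ i))"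
      by (subst nn_integral_distr) auto
    also have "\<dots> = ennreal (2 * R $ i / \<eta> $ i)"
      unfolding a N_def by (rule nn_integral_card_lattice_near[OF pos R_nonneg])
    finally show ?thesis .
  qed
  have N_int: "integrable \<Omega> (\<lambda>\<omega>. N i (c \<omega> $ i))" for i
    by (rule integrableI_nonneg) (auto simp: nn, simp add: N_def)
  have N_exp: "expectation (\<lambda>\<omega>. N i (c \<omega> $ i)) = 2 * R $ i / \<eta> $ i" for i
    using pos[of i] R_nonneg[of i]
    by (subst integral_eq_nn_integral) (auto simp: nn, simp add: N_def)
  have indep: "indep_vars (\<lambda>_. borel) (\<lambda>i \<omega>. N i (c \<omega> $ i)) UNIV"
    by (rule indep_vars_compose2[OF assms(19)]) auto

  \<comment> \<open>With \<open>M\<close> the matrix exponential, \<open>2 * R\<close> is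
    \<open>2 * (M (\<eta>/2 + z) + v u) + \<eta> + 2 * z\<close>. Collecting the terms in
    \<open>\<eta>\<close> and in \<open>z\<close> gives the factor \<open>A = id + M\<close> both
    times.\<close>
  have side: "2 * R $ i / \<eta> $ i = 1 / \<eta> $ i * (p $ i + (\<Sum>j\<in>UNIV. A $ i $ j * \<eta> $ j))" for i
  proof -
    have "r' = matrix_exp (\<tau> *\<^sub>R L u) *v (\<eta> /\<^sub>R 2 + z) + v u"
      unfolding assms(17) using z \<eta>2 by (intro assms(16) add_nonneg_nonneg)
    then have "2 *\<^sub>R R = p + A *v \<eta>"
      unfolding R_def assms(22,23)
      by (simp add: vec_eq_iff matrix_vector_mult_add_rdistrib matrix_vector_right_distrib
          matrix_vector_mult_scaleR algebra_simps)
    then have "2 * R $ i = p $ i + (A *v \<eta>) $ i"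
      by (metis vector_add_component vector_scaleR_component real_scaleR_def)
    then show ?thesis
      by (simp add: matrix_vector_mult_def)
  qed

  \<comment> \<open>Integrable factors alone would not make the product integrable; independence
    does.\<close>
  have "integrable \<Omega> (\<lambda>\<omega>. \<Prod>i\<in>UNIV. N i (c \<omega> $ i))"
    by (rule indep_vars_integrable[OF _ indep]) (auto simp: N_int)
  then have integrable: "integrable \<Omega> (\<lambda>\<omega>. real (card (F2 \<omega> x2 u)))"
    by (subst Bochner_Integration.integrable_cong[OF refl F2_card]) auto
  have "expectation (\<lambda>\<omega>. real (card (F2 \<omega> x2 u))) = expectation (\<lambda>\<omega>. \<Prod>i\<in>UNIV. N i (c \<omega> $ i))"
    by (rule Bochner_Integration.integral_cong[OF refl F2_card])
  also have "\<dots> = (\<Prod>i\<in>UNIV. expectation (\<lambda>\<omega>. N i (c \<omega> $ i)))"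
    by (rule indep_vars_lebesgue_integral[OF _ indep]) (auto simp: N_int)
  also have "\<dots> = (\<Prod>i\<in>UNIV. 1 / \<eta> $ i * (p $ i + (\<Sum>j\<in>UNIV. A $ i $ j * \<eta> $ j)))"
    unfolding N_exp side ..
  finally show ?thesis
    using F2_finite integrable by blast
qed

end
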